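(* Let $N\in\mathbb{N}$ and assume that for all $x\in E_X$ $$\sup_{0\le\tau\le N}\ \sup_{y\in E_Y}\mathbb{E}_{xy}\Big[\sum_{k=0}^{\tau-1}c^+(X_k)+g^+(X_\tau)\Big]<\infty .$$ Suppose that the utility function $U$ is more risk averse than the utility function $W$. Then for all $n=0,1,\dots,N-1$ and all histories $h_n\in E_X^{n+1}$: $g_n^*(h_n,W)=1$ implies $g_n^*(h_n,U)=1$; i.e. a more risk-averse decision maker will not stop later.
   Context: Setting. $E_X,E_Y$ are Borel spaces; $\lambda$ and $\nu$ are $\sigma$-finite measures on $E_X$ and $E_Y$. $(X_n,Y_n)_{n\in\mathbb{N}_0}$ is a Markov process on $E_X\times E_Y$ with transition kernel $Q(B|x,y)=\int_B q(x',y'|x,y)\,\lambda(dx')\,\nu(dy')$, where $q$ is a measurable density. Only $X_n$ is observable. Put $q^X(x'|x,y):=\int_{E_Y}q(x',y'|x,y)\,\nu(dy')$. $\mathbb{P}(E_Y)$ is the set of probability measures on $E_Y$. $Q_0\in\mathbb{P}(E_Y)$ is the known initial distribution of $Y_0$. $\mathbb{E}_{xy}$ is expectation given $X_0=x,Y_0=y$. $c:E_X\to\mathbb{R}$ and $g:E_X\to\mathbb{R}$ are measurable. Stopping times $\tau$ are taken with respect to $\mathcal{F}_n=\sigma(X_0,\dots,X_n)$. Write $a^+=\max\{a,0\}$; empty sums are $0$; expectations and integrals of utilities take values in $[-\infty,\infty)$. Utility functions are strictly increasing concave functions $\mathbb{R}\to\mathbb{R}$; here they are also twice differentiable with positive first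 derivative, so that the Arrow–Pratt function $l_U(x)=-U''(x)/U'(x)$ is defined. $U$ is more risk averse than $W$ if $l_U(x)\ge l_W(x)$ for all $x\in\mathbb{R}$. Updating operator: $$\Phi(x,x',\mu)(B):=\frac{\int_B\int_{E_Y}q(x',y'|x,y)\,\mu(dy)\,\nu(dy')}{\int_{E_Y}q^X(x'|x,y)\,\mu(dy)},\quad B\in\mathcal{B}(E_Y),$$ and $\Phi(x,x',\mu)$ is a fixed arbitrary probability measure if the denominator is not in $(0,\infty)$. Filter: $\mu_0(\cdot|h_0):=Q_0$ and $\mu_{n+1}(\cdot|h_n,x'):=\Phi(x_n,x',\mu_n(\cdot|h_n))$ for $h_n=(x_0,\dots,x_n)\in E_X^{n+1}$. $Q^X(B|x,\mu):=\int_B\int_{E_Y}q^X(x'|x,y)\,\mu(dy)\,\lambda(dx')$. For a utility function $U$ and $(x,\mu,s)\in E_X\times\mathbb{P}(E_Y)\times\mathbb{R}$, let $V_0(x,\mu,s,U)=U(g(x)+s)$ and for $n=1,\dots,N$ $$V_n(x,\mu,s,U)=\max\Big\{U\big(g(x)+s\big),\ \int_{E_X}V_{n-1}\big(x',\Phi(x,x',\mu),s+c(x),U\big)\,Q^X(dx'|x,\mu)\Big\}.$$ (These are the value functions $\sup_{0\le\tau\le n}\int\mathbb{E}_{xy}[U(\sum_{k=0}^{\tau-1}c(X_k)+s+g(X_\tau))]\mu(dy)$.) Let $f_n^*(x,\mu,s,U)=1$ if this maximum is attained at $U(g(x)+s)$, and $0$ otherwise. Define, for $n=0,\dots,N-1$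 and $h_n=(x_0,\dots,x_n)$, $$g_n^*(h_n,U):=f_{N-n}^*\Big(x_n,\mu_n(\cdot|h_n),\sum_{k=0}^{n-1}c(x_k),U\Big).$$ The optimal stopping time is the first $n$ with $g_n^*(h_n,U)=1$ (or $N$ if there is none). The same notation is used with $W$ in place of $U$. *)

theory Defs
  imports "HOL-Probability.Probability"
begin

text \<open>
  Throughout, the measures \<open>lam\<close> on \<open>E\<^sub>X\<close> and \<open>nu\<close> on \<open>E\<^sub>Y\<close> carry the state spaces:
  \<open>space lam = E\<^sub>X\<close>, and \<open>sets lam\<close> is the Borel sigma-algebra of \<open>E\<^sub>X\<close>; likewise for \<open>nu\<close>.
  The density is written \<open>q x' y' x y\<close> for \<open>q(x',y'|x,y)\<close>.
\<close>

text \<open>A Borel space is a Borel subset of a Polish space with its trace sigma-algebra.\<close>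

definition measure_on_borel_space :: "'a::polish_space set \<Rightarrow> 'a measure \<Rightarrow> bool" where
  "measure_on_borel_space E M \<longleftrightarrow> E \<in> sets borel \<and> sets M = sets (restrict_space borel E)"

subsection \<open>The Markov process\<close>

definition joint_kernel ::
  "'x measure \<Rightarrow> 'y measure \<Rightarrow> ('x \<Rightarrow> 'y \<Rightarrow> 'x \<Rightarrow> 'y \<Rightarrow> real) \<Rightarrow> 'x \<times> 'y \<Rightarrow> ('x \<times> 'y) measure" where
  "joint_kernel lam nu q = (\<lambda>(x, y). density (lam \<Otimes>\<^sub>M nu) (\<lambda>(x', y'). ennreal (q x' y' x y)))"

text \<open>Conditional distribution of the \<open>n\<close>-th state given the path \<open>\<omega>\<close> before time \<open>n\<close>, when the
  process starts in \<open>z\<close>.\<close>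

definition step_kernel ::
  "'a measure \<Rightarrow> ('a \<Rightarrow> 'a measure) \<Rightarrow> 'a \<Rightarrow> nat \<Rightarrow> (nat \<Rightarrow> 'a) \<Rightarrow> 'a measure" where
  "step_kernel M K z n \<omega> = (case n of 0 \<Rightarrow> return M z | Suc m \<Rightarrow> K (\<omega> m))"

text \<open>Law on the path space of the Markov process with kernel \<open>K\<close> started in \<open>z\<close>: the
  Ionescu-Tulcea limit of the library, named here by its global constants.\<close>

definition markov_law ::
  "'a measure \<Rightarrow> ('a \<Rightarrow> 'a measure) \<Rightarrow> 'a \<Rightarrow> (nat \<Rightarrow> 'a) measure" where
  "markov_law M K z =
     projective_family.lim UNIV (Ionescu_Tulcea.CI (step_kernel M K z) (\<lambda>_. M)) (\<lambda>_. M)"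

text \<open>The limit exists whenever the kernel is stochastic.\<close>

lemma Ionescu_Tulcea_step_kernel:
  assumes q[measurable]: "(\<lambda>((x', y'), (x, y)). q x' y' x y)
         \<in> borel_measurable ((lam \<Otimes>\<^sub>M nu) \<Otimes>\<^sub>M (lam \<Otimes>\<^sub>M nu))"
  and "sigma_finite_measure lam" "sigma_finite_measure nu"
  and p: "\<forall>x\<in>space lam. \<forall>y\<in>space nu. prob_space (joint_kernel lam nu q (x, y))"
  and z: "z \<in> space (lam \<Otimes>\<^sub>M nu)"
  shows "Ionescu_Tulcea (step_kernel (lam \<Otimes>\<^sub>M nu) (joint_kernel lam nu q) z) (\<lambda>_. lam \<Otimes>\<^sub>M nu)"
proof -
  define f where "f = (\<lambda>((x', y'), (x, y)). q x' y' x y)"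
  have f[measurable]: "f \<in> borel_measurable ((lam \<Otimes>\<^sub>M nu) \<Otimes>\<^sub>M (lam \<Otimes>\<^sub>M nu))" using q by (simp add: f_def)
  interpret pair_sigma_finite lam nu using assms by (simp add: pair_sigma_finite_def)
  let ?M = "lam \<Otimes>\<^sub>M nu"
  have ps: "prob_space (joint_kernel lam nu q z)" if "z \<in> space ?M" for z
    using p that by (auto simp: space_pair_measure)
  have K: "joint_kernel lam nu q \<in> ?M \<rightarrow>\<^sub>M subprob_algebra ?M"
  proof (rule measurable_subprob_algebra)
    fix z assume "z \<in> space ?M"
    then show "subprob_space (joint_kernel lam nu q z)" by (intro prob_space_imp_subprob_space ps)
    show "sets (joint_kernel lam nu q z) = sets ?M" by (auto simp: joint_kernel_def split: prod.split)
  next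
    fix A assume [measurable]: "A \<in> sets ?M"
    have "(\<lambda>z. \<integral>\<^sup>+ w. ennreal (f (w, z)) * indicator A w \<partial>?M) \<in> borel_measurable ?M"
      by measurable
    moreover have "emeasure (joint_kernel lam nu q z) A = (\<integral>\<^sup>+ w. ennreal (f (w, z)) * indicator A w \<partial>?M)"
      if "z \<in> space ?M" for z
    proof -
      have [measurable]: "(\<lambda>w. f (w, z)) \<in> borel_measurable ?M"
        using that by measurable
      have e: "joint_kernel lam nu q z = density ?M (\<lambda>w. ennreal (f (w, z)))"
        by (auto simp: joint_kernel_def f_def split: prod.split intro!: arg_cong2[where f=density])
      show ?thesis unfolding e by (subst emeasure_density) auto
    qed
    ultimately show "(\<lambda>z. emeasure (joint_kernel lam nu q z) A) \<in> borel_measurable ?M"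
      by (subst measurable_cong) auto
  qed
  show ?thesis
  proof (rule Ionescu_Tulcea.intro)
    fix i
    show "step_kernel ?M (joint_kernel lam nu q) z i \<in> PiM {0..<i} (\<lambda>_. ?M) \<rightarrow>\<^sub>M subprob_algebra ?M"
    proof (cases i)
      case 0
      then show ?thesis using z
        by (auto simp: step_kernel_def[abs_def] space_subprob_algebra
              intro!: measurable_const prob_space_imp_subprob_space prob_space_return)
    next
      case (Suc m)
      then show ?thesis using K
        by (auto simp: step_kernel_def[abs_def] intro!: measurable_compose[OF _ K])
    qed
    fix x assume "x \<in> space (PiM {0..<i} (\<lambda>_. ?M))"
    then show "prob_space (step_kernel ?M (joint_kernel lam nu q) z i x)"
      using z by (cases i) (auto simp: step_kernel_def space_PiM PiE_iff intro!: prob_space_return ps)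
  qed
qed

definition path_space :: "'x measure \<Rightarrow> 'y measure \<Rightarrow> (nat \<Rightarrow> 'x \<times> 'y) set" where
  "path_space lam nu = space (PiM UNIV (\<lambda>_. lam \<Otimes>\<^sub>M nu))"

text \<open>\<open>\<F>\<^sub>n = \<sigma>(X\<^sub>0,\<dots>,X\<^sub>n)\<close>, where \<open>X\<^sub>k \<omega> = fst (\<omega> k)\<close>.\<close>

definition obs_filtration ::
  "'x measure \<Rightarrow> 'y measure \<Rightarrow> nat \<Rightarrow> (nat \<Rightarrow> 'x \<times> 'y) measure" where
  "obs_filtration lam nu n =
     sigma (path_space lam nu)
       {(\<lambda>\<omega>. fst (\<omega> k)) -` A \<inter> path_space lam nu | k A. k \<le> n \<and> A \<in> sets lam}"

definition stopping_times_upto ::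
  "'x measure \<Rightarrow> 'y measure \<Rightarrow> nat \<Rightarrow> ((nat \<Rightarrow> 'x \<times> 'y) \<Rightarrow> nat) set" where
  "stopping_times_upto lam nu N =
     {\<tau>. stopping_time (obs_filtration lam nu) \<tau> \<and> (\<forall>\<omega>\<in>path_space lam nu. \<tau> \<omega> \<le> N)}"

text \<open>The expectation \<open>\<bbbE>\<^sub>x\<^sub>y[\<Sum>k<\<tau>. c\<^sup>+(X\<^sub>k) + g\<^sup>+(X\<^sub>\<tau>)]\<close>.\<close>

definition exp_pos_reward ::
  "'x measure \<Rightarrow> 'y measure \<Rightarrow> ('x \<Rightarrow> 'y \<Rightarrow> 'x \<Rightarrow> 'y \<Rightarrow> real) \<Rightarrow> ('x \<Rightarrow> real) \<Rightarrow> ('x \<Rightarrow> real) \<Rightarrow>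
   ((nat \<Rightarrow> 'x \<times> 'y) \<Rightarrow> nat) \<Rightarrow> 'x \<Rightarrow> 'y \<Rightarrow> ennreal" where
  "exp_pos_reward lam nu q c g \<tau> x y =
     (\<integral>\<^sup>+ \<omega>. ennreal ((\<Sum>k<\<tau> \<omega>. max (c (fst (\<omega> k))) 0) + max (g (fst (\<omega> (\<tau> \<omega>)))) 0)
       \<partial>markov_law (lam \<Otimes>\<^sub>M nu) (joint_kernel lam nu q) (x, y))"

subsection \<open>Utility functions and risk aversion\<close>

definition utility :: "(real \<Rightarrow> real) \<Rightarrow> bool" where
  "utility U \<longleftrightarrow> strict_mono U \<and> concave_on UNIV U \<and>
     (\<forall>x. U differentiable (at x)) \<and> (\<forall>x. deriv U differentiable (at x)) \<and> (\<forall>x. deriv U x > 0)"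

definition arrow_pratt :: "(real \<Rightarrow> real) \<Rightarrow> real \<Rightarrow> real" where
  "arrow_pratt U x = - deriv (deriv U) x / deriv U x"

definition more_risk_averse :: "(real \<Rightarrow> real) \<Rightarrow> (real \<Rightarrow> real) \<Rightarrow> bool" where
  "more_risk_averse U W \<longleftrightarrow> (\<forall>x. arrow_pratt U x \<ge> arrow_pratt W x)"

subsection \<open>Filter\<close>

definition marg_density ::
  "'y measure \<Rightarrow> ('x \<Rightarrow> 'y \<Rightarrow> 'x \<Rightarrow> 'y \<Rightarrow> real) \<Rightarrow> 'x \<Rightarrow> 'x \<Rightarrow> 'y \<Rightarrow> ennreal" where
  "marg_density nu q x' x y = (\<integral>\<^sup>+ y'. ennreal (q x' y' x y) \<partial>nu)"

definition obs_kernel ::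
  "'x measure \<Rightarrow> 'y measure \<Rightarrow> ('x \<Rightarrow> 'y \<Rightarrow> 'x \<Rightarrow> 'y \<Rightarrow> real) \<Rightarrow> 'x \<Rightarrow> 'y measure \<Rightarrow> 'x measure" where
  "obs_kernel lam nu q x \<mu> = density lam (\<lambda>x'. \<integral>\<^sup>+ y. marg_density nu q x' x y \<partial>\<mu>)"

text \<open>Updating operator \<open>\<Phi>(x,x',\<mu>)\<close>; \<open>mubar\<close> is the fixed arbitrary probability measure used where
  Bayes' formula is not defined.\<close>

definition update ::
  "'y measure \<Rightarrow> ('x \<Rightarrow> 'y \<Rightarrow> 'x \<Rightarrow> 'y \<Rightarrow> real) \<Rightarrow> 'y measure \<Rightarrow> 'x \<Rightarrow> 'x \<Rightarrow> 'y measure \<Rightarrow> 'y measure" where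
  "update nu q mubar x x' \<mu> =
     (let d = \<integral>\<^sup>+ y. marg_density nu q x' x y \<partial>\<mu>
      in if 0 < d \<and> d < \<infinity>
         then scale_measure (inverse d) (density nu (\<lambda>y'. \<integral>\<^sup>+ y. ennreal (q x' y' x y) \<partial>\<mu>))
         else mubar)"

text \<open>A history \<open>h\<^sub>n = (x\<^sub>0,\<dots>,x\<^sub>n)\<close> is a sequence \<open>h\<close> with \<open>h k = x\<^sub>k\<close> of which only the entries
  \<open>k \<le> n\<close> are used.\<close>

primrec filter_dist ::
  "'y measure \<Rightarrow> ('x \<Rightarrow> 'y \<Rightarrow> 'x \<Rightarrow> 'y \<Rightarrow> real) \<Rightarrow> 'y measure \<Rightarrow> 'y measure \<Rightarrow>
   nat \<Rightarrow> (nat \<Rightarrow> 'x) \<Rightarrow> 'y measure" where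
  "filter_dist nu q mubar Q0 0 h = Q0"
| "filter_dist nu q mubar Q0 (Suc n) h =
     update nu q mubar (h n) (h (Suc n)) (filter_dist nu q mubar Q0 n h)"

subsection \<open>Value functions and stopping rules\<close>

text \<open>Integral of an extended real function as positive part minus negative part. It is used where
  the positive part has finite integral, so that its values lie in \<open>[-\<infinity>,\<infinity>)\<close>.\<close>

definition ext_integral :: "'a measure \<Rightarrow> ('a \<Rightarrow> ereal) \<Rightarrow> ereal" where
  "ext_integral M f =
     enn2ereal (\<integral>\<^sup>+ x. e2ennreal (max (f x) 0) \<partial>M) - enn2ereal (\<integral>\<^sup>+ x. e2ennreal (max (- f x) 0) \<partial>M)"

primrec value_fun ::
  "'x measure \<Rightarrow> 'y measure \<Rightarrow> ('x \<Rightarrow> 'y \<Rightarrow> 'x \<Rightarrow> 'y \<Rightarrow> real) \<Rightarrow> ('x \<Rightarrow> real) \<Rightarrow> ('x \<Rightarrow> real) \<Rightarrow>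
   'y measure \<Rightarrow> nat \<Rightarrow> 'x \<Rightarrow> 'y measure \<Rightarrow> real \<Rightarrow> (real \<Rightarrow> real) \<Rightarrow> ereal" where
  "value_fun lam nu q c g mubar 0 x \<mu> s U = ereal (U (g x + s))"
| "value_fun lam nu q c g mubar (Suc n) x \<mu> s U =
     max (ereal (U (g x + s)))
         (ext_integral (obs_kernel lam nu q x \<mu>)
            (\<lambda>x'. value_fun lam nu q c g mubar n x' (update nu q mubar x x' \<mu>) (s + c x) U))"

definition stop_rule ::
  "'x measure \<Rightarrow> 'y measure \<Rightarrow> ('x \<Rightarrow> 'y \<Rightarrow> 'x \<Rightarrow> 'y \<Rightarrow> real) \<Rightarrow> ('x \<Rightarrow> real) \<Rightarrow> ('x \<Rightarrow> real) \<Rightarrow>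
   'y measure \<Rightarrow> nat \<Rightarrow> 'x \<Rightarrow> 'y measure \<Rightarrow> real \<Rightarrow> (real \<Rightarrow> real) \<Rightarrow> nat" where
  "stop_rule lam nu q c g mubar n x \<mu> s U =
     (if value_fun lam nu q c g mubar n x \<mu> s U = ereal (U (g x + s)) then 1 else 0)"

definition hist_rule ::
  "'x measure \<Rightarrow> 'y measure \<Rightarrow> ('x \<Rightarrow> 'y \<Rightarrow> 'x \<Rightarrow> 'y \<Rightarrow> real) \<Rightarrow> ('x \<Rightarrow> real) \<Rightarrow> ('x \<Rightarrow> real) \<Rightarrow>
   'y measure \<Rightarrow> 'y measure \<Rightarrow> nat \<Rightarrow> nat \<Rightarrow> (nat \<Rightarrow> 'x) \<Rightarrow> (real \<Rightarrow> real) \<Rightarrow> nat" where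
  "hist_rule lam nu q c g mubar Q0 N n h U =
     stop_rule lam nu q c g mubar (N - n) (h n) (filter_dist nu q mubar Q0 n h) (\<Sum>k<n. c (h k)) U"

text \<open>The optimal stopping time: the first \<open>n < N\<close> at which the rule says stop, and \<open>N\<close> if there is
  none.\<close>

definition opt_stop ::
  "'x measure \<Rightarrow> 'y measure \<Rightarrow> ('x \<Rightarrow> 'y \<Rightarrow> 'x \<Rightarrow> 'y \<Rightarrow> real) \<Rightarrow> ('x \<Rightarrow> real) \<Rightarrow> ('x \<Rightarrow> real) \<Rightarrow>
   'y measure \<Rightarrow> 'y measure \<Rightarrow> nat \<Rightarrow> (nat \<Rightarrow> 'x) \<Rightarrow> (real \<Rightarrow> real) \<Rightarrow> nat" where
  "opt_stop lam nu q c g mubar Q0 N h U =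
     (LEAST n. n = N \<or> (n < N \<and> hist_rule lam nu q c g mubar Q0 N n h U = 1))"

end

theory Submission
  imports Defs
begin

text \<open>
  If \<open>U\<close> is more risk averse than \<open>W\<close>, then \<open>U\<close> is an increasing concave function of \<open>W\<close> (Pratt).
  The textbook argument would transport a stopping problem for \<open>W\<close> to one for \<open>U\<close> with
  Jensen's inequality. It is enough to use one supporting line of that concave function:
  for a fixed wealth \<open>t\<^sub>0\<close> there are \<open>a > 0\<close> and \<open>b\<close> with \<open>U \<le> a W + b\<close> everywhere and equality
  at \<open>t\<^sub>0\<close> (\<open>more_risk_averse_affine_majorant\<close>).

  Increasing affine maps commute with the value iteration: they commute with maxima, and with
  integrals because the observation kernel has total mass one. Since the iteration is also monotone,
  \<open>U \<le> a W + b\<close> passes to \<open>V\<^sub>n(\<cdot>,U) \<le> a V\<^sub>n(\<cdot>,W) + b\<close> for all \<open>n\<close> (\<open>value_fun_le_affine\<close>). Now suppose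
  that stopping in \<open>(x,\<mu>,s)\<close> is optimal for \<open>W\<close>, and choose \<open>t\<^sub>0 = g(x) + s\<close>, the wealth
  after stopping. Then
  \<open>V\<^sub>n(x,\<mu>,s,U) \<le> a W(t\<^sub>0) + b = U(t\<^sub>0) \<le> V\<^sub>n(x,\<mu>,s,U)\<close>,
  so stopping is optimal for \<open>U\<close> as well. Along a history this says that every time at which the
  rule for \<open>W\<close> stops is one at which the rule for \<open>U\<close> stops, so the first such time for \<open>U\<close> is
  not later.

  Additivity of the integral, and so the commutation with \<open>b\<close>, depends on measurability of
  \<open>x' \<mapsto> V\<^sub>n(x', \<Phi>(x,x',\<mu>), s)\<close>. It is obtained jointly in the state \<open>(x,\<mu>,s)\<close>, with the Giry sigma-algebra
  on the beliefs \<open>\<mu>\<close>; the main points there are that the updating operator is a measurable map into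
  the probability measures (\<open>update_measurable\<close>) and that its normalising constant is a
  probability density of the next observation (\<open>obs_kernel_prob_space\<close>).
\<close>

section \<open>Comparing two utilities by an affine majorant\<close>

lemma utility_DERIV:
  assumes "utility U"
  shows "(U has_real_derivative deriv U x) (at x)"
    and "(deriv U has_real_derivative deriv (deriv U) x) (at x)"
    and "deriv U x > 0"
  using assms unfolding utility_def
  by (auto simp: DERIV_deriv_iff_real_differentiable)

text \<open>
  The Arrow--Pratt function is minus the logarithmic derivative of marginal utility, so
  \<open>(log (U'/W'))' = l\<^sub>W - l\<^sub>U \<le> 0\<close>. The proof differentiates the quotient itself.
\<close>

lemma marginal_utility_ratio_antimono:
  assumes U: "utility U" and W: "utility W" and risk: "more_risk_averse U W"
  assumes "x \<le> y"
  shows "deriv U y / deriv W y \<le> deriv U x / deriv W x"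
proof (rule DERIV_nonpos_imp_nonincreasing[OF \<open>x \<le> y\<close>])
  fix t
  let ?u = "deriv U t" and ?u' = "deriv (deriv U) t"
  let ?w = "deriv W t" and ?w' = "deriv (deriv W) t"
  have pos: "?u > 0" "?w > 0"
    using utility_DERIV(3)[OF U] utility_DERIV(3)[OF W] by auto
  have "((\<lambda>t. deriv U t / deriv W t) has_real_derivative (?u' * ?w - ?u * ?w') / (?w * ?w)) (at t)"
    using pos by (intro DERIV_divide utility_DERIV(2)[OF U] utility_DERIV(2)[OF W]) auto
  moreover have "(?u' * ?w - ?u * ?w') / (?w * ?w) \<le> 0"
  proof -
    have "- ?w' / ?w \<le> - ?u' / ?u"
      using risk by (auto simp: more_risk_averse_def arrow_pratt_def)
    then have "?u' * ?w - ?u * ?w' \<le> 0"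
      using pos by (simp add: field_simps)
    then show ?thesis
      using pos by (simp add: divide_nonpos_pos)
  qed
  ultimately show "\<exists>d. ((\<lambda>t. deriv U t / deriv W t) has_real_derivative d) (at t) \<and> d \<le> 0"
    by blast
qed

text \<open>
  The derivative of \<open>a W + b - U\<close> is \<open>W' (a - U'/W')\<close>. With \<open>a\<close> the value of the decreasing ratio
  \<open>U'/W'\<close> at \<open>t\<^sub>0\<close>, it is nonpositive before \<open>t\<^sub>0\<close> and nonnegative after, so the difference has
  its minimum at \<open>t\<^sub>0\<close>, where \<open>b\<close> makes it vanish.
\<close>

lemma more_risk_averse_affine_majorant:
  assumes U: "utility U" and W: "utility W" and risk: "more_risk_averse U W"
  obtains a b where "a > 0" "\<And>t. U t \<le> a * W t + b" "U t\<^sub>0 = a * W t\<^sub>0 + b"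
proof
  define a where "a = deriv U t\<^sub>0 / deriv W t\<^sub>0"
  define b where "b = U t\<^sub>0 - a * W t\<^sub>0"
  define D where "D = (\<lambda>t. a * W t + b - U t)"
  have D': "(D has_real_derivative a * deriv W t - deriv U t) (at t)" for t
    unfolding D_def by (auto intro!: derivative_eq_intros utility_DERIV(1)[OF U] utility_DERIV(1)[OF W])
  have ratio: "deriv U y / deriv W y \<le> deriv U x / deriv W x" if "x \<le> y" for x y
    by (rule marginal_utility_ratio_antimono[OF U W risk that])
  have W_pos: "deriv W t > 0" for t
    by (rule utility_DERIV(3)[OF W])
  have "D t\<^sub>0 \<le> D t" for t
  proof (cases "t\<^sub>0 \<le> t")
    case True
    show ?thesis
    proof (rule DERIV_nonneg_imp_nondecreasing[OF True], intro exI conjI)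
      fix s assume "t\<^sub>0 \<le> s"
      then show "a * deriv W s - deriv U s \<ge> 0"
        using ratio[of t\<^sub>0 s] W_pos[of s] by (simp add: a_def[symmetric] pos_divide_le_eq)
    qed (rule D')
  next
    case False
    then have "t \<le> t\<^sub>0"
      by simp
    then show ?thesis
    proof (rule DERIV_nonpos_imp_nonincreasing, intro exI conjI)
      fix s assume "s \<le> t\<^sub>0"
      then show "a * deriv W s - deriv U s \<le> 0"
        using ratio[of s t\<^sub>0] W_pos[of s] by (simp add: a_def[symmetric] pos_le_divide_eq)
    qed (rule D')
  qed
  then show "U t \<le> a * W t + b" for t
    by (simp add: D_def b_def)
  show "U t\<^sub>0 = a * W t\<^sub>0 + b"
    by (simp add: b_def)
  show "a > 0"
    using utility_DERIV(3)[OF U] W_pos by (simp add: a_def)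
qed

lemma utility_borel_measurable:
  assumes "utility U"
  shows "U \<in> borel_measurable borel"
  using utility_DERIV(1)[OF assms]
  by (intro borel_measurable_continuous_onI continuous_at_imp_continuous_on) (auto intro: DERIV_isCont)

section \<open>The extended integral\<close>

text \<open>
  This is monotonicity and affine equivariance of the integral in one step. The integral is a
  difference of two integrals with values in \<open>[0,\<infinity>]\<close>, either of which may be infinite, so the
  pointwise hypothesis is first written without subtraction,
  \<open>f\<^sup>+ + a h\<^sup>- + b\<^sup>- \<le> f\<^sup>- + a h\<^sup>+ + b\<^sup>+\<close>, then integrated, and only then rearranged.
\<close>

lemma ext_integral_affine_mono:
  assumes "prob_space M"
  assumes f[measurable]: "f \<in> borel_measurable M" and h[measurable]: "h \<in> borel_measurable M"
  assumes "a > 0" and le: "\<And>x. x \<in> space M \<Longrightarrow> f x \<le> ereal a * h x + ereal b"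
  shows "ext_integral M f \<le> ereal a * ext_integral M h + ereal b"
proof -
  interpret prob_space M by fact
  define pos neg :: "('a \<Rightarrow> ereal) \<Rightarrow> 'a \<Rightarrow> ennreal"
    where "pos = (\<lambda>f x. e2ennreal (max (f x) 0))" and "neg = (\<lambda>f x. e2ennreal (max (- f x) 0))"
  have [measurable]: "pos f \<in> borel_measurable M" "neg f \<in> borel_measurable M"
    "pos h \<in> borel_measurable M" "neg h \<in> borel_measurable M"
    unfolding pos_def neg_def by measurable
  let ?p = "\<lambda>f. \<integral>\<^sup>+x. pos f x \<partial>M" and ?n = "\<lambda>f. \<integral>\<^sup>+x. neg f x \<partial>M"
  have ext: "ext_integral M f = enn2ereal (?p f) - enn2ereal (?n f)" for f
    by (simp add: ext_integral_def pos_def neg_def)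
  let ?a = "ennreal a" and ?b = "ennreal b" and ?b' = "ennreal (- b)"
  show ?thesis
  proof (cases "?p h = \<infinity>")
    \<comment> \<open>The right-hand side is \<open>\<infinity>\<close>, also for an infinite negative part, as \<open>\<infinity> - \<infinity> = \<infinity>\<close> in \<^typ>\<open>ereal\<close>.\<close>
    case True
    then show ?thesis
      using \<open>a > 0\<close> by (cases "?n h") (auto simp: ext)
  next
    case False
    have combine: "ennreal (u + a * v + w) = ennreal u + ?a * ennreal v + ennreal w"
      if "u \<ge> 0" "v \<ge> 0" "w \<ge> 0" for u v w
      using that \<open>a > 0\<close> by (simp add: ennreal_mult)
    have b: "?b = ennreal (max b 0)" "?b' = ennreal (max (- b) 0)"
      by simp_all
    have pos_le: "pos f x \<le> ?a * pos h x + ?b"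
      and balance: "pos f x + ?a * neg h x + ?b' \<le> neg f x + ?a * pos h x + ?b"
      if x: "x \<in> space M" for x
    proof -
      have e2: "e2ennreal (max (ereal r) 0) = ennreal (max r 0)" for r
        by (simp add: max_def e2ennreal_ereal zero_ereal_def)
      have "pos f x \<le> ?a * pos h x + ?b \<and>
          pos f x + ?a * neg h x + ?b' \<le> neg f x + ?a * pos h x + ?b"
      proof (cases "h x")
        case PInf
        then show ?thesis
          using \<open>a > 0\<close> by (simp add: pos_def ennreal_mult_top)
      next
        case MInf
        then have "f x = - \<infinity>"
          using le[OF x] \<open>a > 0\<close> by simp
        then show ?thesis
          by (simp add: pos_def neg_def)
      next
        case (real r)
        show ?thesis
        proof (cases "f x")
          case PInf
          then show ?thesis
            using le[OF x] real by simp
        next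
          case MInf
          then show ?thesis
            by (simp add: pos_def neg_def)
        next
          case f: (real t)
          have t: "t \<le> a * r + b"
            using le[OF x] real f by simp
          have e3: "max (- ereal r) 0 = max (ereal (- r)) 0" for r
            by simp
          have le1: "max t 0 \<le> a * max r 0 + max b 0"
          proof -
            have "a * r \<le> a * max r 0" "0 \<le> a * max r 0"
              using \<open>a > 0\<close> by (auto intro: mult_left_mono)
            with t show ?thesis
              by linarith
          qed
          have le2: "max t 0 + a * max (- r) 0 + max (- b) 0
              \<le> max (- t) 0 + a * max r 0 + max b 0"
          proof -
            have "a * r = a * max r 0 - a * max (- r) 0"
              by (simp add: max_def)
            with t show ?thesis
              by linarith
          qed
          show ?thesis
            unfolding pos_def neg_def real f e3 e2 b
            using combine[of 0 "max r 0" "max b 0"]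
              combine[of "max t 0" "max (- r) 0" "max (- b) 0"]
              combine[of "max (- t) 0" "max r 0" "max b 0"]
              ennreal_leI[OF le1] ennreal_leI[OF le2]
            by simp
        qed
      qed
      then show "pos f x \<le> ?a * pos h x + ?b"
        "pos f x + ?a * neg h x + ?b' \<le> neg f x + ?a * pos h x + ?b"
        by auto
    qed
    have "?p f \<le> (\<integral>\<^sup>+x. ?a * pos h x + ?b \<partial>M)"
      by (intro nn_integral_mono pos_le)
    also have "\<dots> = ?a * ?p h + ?b"
      by (simp add: nn_integral_add nn_integral_cmult emeasure_space_1)
    finally have fin: "?p f \<le> ?a * ?p h + ?b" .
    have "(\<integral>\<^sup>+x. pos f x + ?a * neg h x + ?b' \<partial>M) \<le> (\<integral>\<^sup>+x. neg f x + ?a * pos h x + ?b \<partial>M)"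
      by (intro nn_integral_mono balance)
    then have bal: "?p f + ?a * ?n h + ?b' \<le> ?n f + ?a * ?p h + ?b"
      by (simp add: nn_integral_add nn_integral_cmult emeasure_space_1)
    obtain ph where ph: "?p h = ennreal ph" "ph \<ge> 0"
      using False by (cases "?p h") auto
    obtain pf where pf: "?p f = ennreal pf" "pf \<ge> 0"
      using fin \<open>a > 0\<close> unfolding ph by (cases "?p f") (auto simp: ennreal_mult_eq_top_iff top_unique)
    show ?thesis
    proof (cases "?n f")
      \<comment> \<open>The positive part of \<open>f\<close> is finite, so its integral is \<open>-\<infinity>\<close>.\<close>
      case top
      then show ?thesis
        by (simp add: ext pf)
    next
      case nf: (real nf)
      obtain nh where nh: "?n h = ennreal nh" "nh \<ge> 0"
        using bal \<open>a > 0\<close> unfolding ph pf nf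
        by (cases "?n h") (auto simp: ennreal_mult_top ennreal_mult_eq_top_iff top_unique)
      have "ennreal (pf + a * nh + max (- b) 0) \<le> ennreal (nf + a * ph + max b 0)"
        using bal nf(1) ph(2) pf(2) nh(2) unfolding ph(1) pf(1) nf(2) nh(1) b
        by (simp only: combine max.cobounded2)
      moreover have "0 \<le> nf + a * ph + max b 0"
        using nf(1) ph(2) \<open>a > 0\<close> by simp
      ultimately have "pf + a * nh + max (- b) 0 \<le> nf + a * ph + max b 0"
        by (simp only: ennreal_le_iff)
      then have "pf - nf \<le> a * (ph - nh) + b"
        by (simp add: max_def algebra_simps split: if_splits)
      then show ?thesis
        using nf ph pf nh by (simp add: ext)
    qed
  qed
qed

section \<open>Measurability of the filter and of the value functions\<close>

text \<open>
  The density with respect to \<open>lam\<close> of the next observation \<open>x'\<close> under the belief \<open>\<mu>\<close>. The same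
  number is the denominator of Bayes' formula for the next belief.
\<close>

definition obs_density ::
  "'y measure \<Rightarrow> ('x \<Rightarrow> 'y \<Rightarrow> 'x \<Rightarrow> 'y \<Rightarrow> real) \<Rightarrow> 'x \<Rightarrow> 'y measure \<Rightarrow> 'x \<Rightarrow> ennreal" where
  "obs_density nu q x \<mu> x' = (\<integral>\<^sup>+ y. marg_density nu q x' x y \<partial>\<mu>)"

locale density_model = lam: sigma_finite_measure lam + nu: sigma_finite_measure nu
  for lam :: "'x measure" and nu :: "'y measure" +
  fixes q :: "'x \<Rightarrow> 'y \<Rightarrow> 'x \<Rightarrow> 'y \<Rightarrow> real" and mubar :: "'y measure"
  assumes q_measurable:
      "(\<lambda>((x', y'), (x, y)). q x' y' x y) \<in> borel_measurable ((lam \<Otimes>\<^sub>M nu) \<Otimes>\<^sub>M (lam \<Otimes>\<^sub>M nu))"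
    and q_kernel: "x \<in> space lam \<Longrightarrow> y \<in> space nu \<Longrightarrow> prob_space (joint_kernel lam nu q (x, y))"
    and mubar: "mubar \<in> space (prob_algebra nu)"
begin

lemma q_compose_measurable[measurable (raw)]:
  assumes [measurable]: "a \<in> M \<rightarrow>\<^sub>M lam" "b \<in> M \<rightarrow>\<^sub>M nu" "c \<in> M \<rightarrow>\<^sub>M lam" "d \<in> M \<rightarrow>\<^sub>M nu"
  shows "(\<lambda>w. q (a w) (b w) (c w) (d w)) \<in> borel_measurable M"
proof -
  have "(\<lambda>w. ((a w, b w), (c w, d w))) \<in> M \<rightarrow>\<^sub>M (lam \<Otimes>\<^sub>M nu) \<Otimes>\<^sub>M (lam \<Otimes>\<^sub>M nu)"
    by measurable
  from measurable_compose[OF this q_measurable] show ?thesis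
    by simp
qed

lemma marg_density_measurable[measurable (raw)]:
  assumes [measurable]: "a \<in> M \<rightarrow>\<^sub>M lam" "b \<in> M \<rightarrow>\<^sub>M lam" "d \<in> M \<rightarrow>\<^sub>M nu"
  shows "(\<lambda>w. marg_density nu q (a w) (b w) (d w)) \<in> borel_measurable M"
  unfolding marg_density_def by measurable

text \<open>
  A belief that varies measurably is a kernel, and integration against a kernel preserves
  measurability in the parameter.
\<close>

lemma nn_integral_belief_measurable:
  assumes f: "(\<lambda>(w, y). f w y) \<in> borel_measurable (M \<Otimes>\<^sub>M nu)" and m: "m \<in> M \<rightarrow>\<^sub>M prob_algebra nu"
  shows "(\<lambda>w. \<integral>\<^sup>+ y. f w y \<partial>m w) \<in> borel_measurable M"
  by (rule nn_integral_measurable_subprob_algebra2[OF f measurable_prob_algebraD[OF m]])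

lemma obs_density_measurable[measurable (raw)]:
  assumes [measurable]: "a \<in> M \<rightarrow>\<^sub>M lam" "m \<in> M \<rightarrow>\<^sub>M prob_algebra nu" "b \<in> M \<rightarrow>\<^sub>M lam"
  shows "(\<lambda>w. obs_density nu q (a w) (m w) (b w)) \<in> borel_measurable M"
  unfolding obs_density_def by (rule nn_integral_belief_measurable) measurable

lemma predictive_density_measurable[measurable (raw)]:
  assumes [measurable]: "a \<in> M \<rightarrow>\<^sub>M lam" "b \<in> M \<rightarrow>\<^sub>M nu" "c \<in> M \<rightarrow>\<^sub>M lam" "m \<in> M \<rightarrow>\<^sub>M prob_algebra nu"
  shows "(\<lambda>w. \<integral>\<^sup>+ y. ennreal (q (a w) (b w) (c w) y) \<partial>m w) \<in> borel_measurable M"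
  by (rule nn_integral_belief_measurable) measurable

lemma belief_sigma_finite:
  assumes "\<mu> \<in> space (prob_algebra nu)"
  shows "prob_space \<mu>" "sets \<mu> = sets nu" "pair_sigma_finite \<mu> nu"
  using assms nu.sigma_finite_measure_axioms
  by (auto simp: space_prob_algebra pair_sigma_finite_def prob_space_imp_sigma_finite)

text \<open>
  By Tonelli, the denominator of Bayes' formula is the total mass of its numerator; this is what
  makes the updated belief a probability measure.
\<close>

lemma obs_density_eq_predictive_mass:
  assumes "x \<in> space lam" "x' \<in> space lam" "\<mu> \<in> space (prob_algebra nu)"
  shows "obs_density nu q x \<mu> x' = (\<integral>\<^sup>+ y'. (\<integral>\<^sup>+ y. ennreal (q x' y' x y) \<partial>\<mu>) \<partial>nu)"
proof -
  note belief_sigma_finite[OF assms(3)]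
  interpret pair_sigma_finite \<mu> nu by fact
  have [measurable_cong]: "sets \<mu> = sets nu" by fact
  note assms(1,2)[measurable]
  show ?thesis
    unfolding obs_density_def marg_density_def by (rule Fubini'[symmetric]) measurable
qed

lemma update_altdef:
  "update nu q mubar x x' \<mu> =
     (if 0 < obs_density nu q x \<mu> x' \<and> obs_density nu q x \<mu> x' < \<infinity>
      then scale_measure (inverse (obs_density nu q x \<mu> x'))
             (density nu (\<lambda>y'. \<integral>\<^sup>+ y. ennreal (q x' y' x y) \<partial>\<mu>))
      else mubar)"
  by (simp add: update_def obs_density_def Let_def)

lemma update_prob:
  assumes x: "x \<in> space lam" "x' \<in> space lam" and m: "\<mu> \<in> space (prob_algebra nu)"
  shows "update nu q mubar x x' \<mu> \<in> space (prob_algebra nu)"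
proof (cases "0 < obs_density nu q x \<mu> x' \<and> obs_density nu q x \<mu> x' < \<infinity>")
  case True
  note [measurable] = x m
  let ?d = "obs_density nu q x \<mu> x'"
  have "emeasure (density nu (\<lambda>y'. \<integral>\<^sup>+ y. ennreal (q x' y' x y) \<partial>\<mu>)) (space nu) = ?d"
    using x m by (subst emeasure_density)
      (auto simp: obs_density_eq_predictive_mass intro!: nn_integral_cong predictive_density_measurable)
  then have "emeasure (update nu q mubar x x' \<mu>) (space nu) = inverse ?d * ?d"
    using True by (simp add: update_altdef)
  also have "\<dots> = 1"
    using True ennreal_divide_self[of ?d]
    by (simp add: divide_ennreal_def mult.commute zero_less_iff_neq_zero)
  finally show ?thesis
    using True by (auto simp: update_altdef space_prob_algebra space_scale_measure intro!: prob_spaceI)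
next
  case False
  then show ?thesis
    using mubar by (simp only: update_altdef if_False)
qed

text \<open>
  The Giry sigma-algebra is generated by the evaluations at sets \<open>B\<close>. Each evaluation of the
  updated belief is a quotient of two parameter integrals, on the measurable set where the
  denominator is in \<open>(0,\<infinity>)\<close>, and constant elsewhere.
\<close>

lemma update_measurable[measurable (raw)]:
  assumes [measurable]: "a \<in> M \<rightarrow>\<^sub>M lam" "b \<in> M \<rightarrow>\<^sub>M lam" "m \<in> M \<rightarrow>\<^sub>M prob_algebra nu"
  shows "(\<lambda>w. update nu q mubar (a w) (b w) (m w)) \<in> M \<rightarrow>\<^sub>M prob_algebra nu"
proof -
  have *: "update nu q mubar (a w) (b w) (m w) \<in> space (prob_algebra nu)" if "w \<in> space M" for w
    using that by (intro update_prob) (auto intro: measurable_space[OF assms(1)] measurable_space[OF assms(2)] measurable_space[OF assms(3)])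
  show ?thesis
  proof (intro measurable_prob_algebraI measurable_subprob_algebra)
    fix w assume "w \<in> space M"
    from *[OF this] show "prob_space (update nu q mubar (a w) (b w) (m w))"
      "subprob_space (update nu q mubar (a w) (b w) (m w))"
      "sets (update nu q mubar (a w) (b w) (m w)) = sets nu"
      by (auto simp: space_prob_algebra prob_space_imp_subprob_space)
  next
    fix B assume [measurable]: "B \<in> sets nu"
    let ?d = "\<lambda>w. obs_density nu q (a w) (m w) (b w)"
    let ?e = "\<lambda>w. if 0 < ?d w \<and> ?d w < \<infinity>
      then inverse (?d w) * (\<integral>\<^sup>+ y'. (\<integral>\<^sup>+ y. ennreal (q (b w) y' (a w) y) \<partial>m w) * indicator B y' \<partial>nu)
      else emeasure mubar B"
    have "?e \<in> borel_measurable M"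
      by measurable
    moreover have "emeasure (update nu q mubar (a w) (b w) (m w)) B = ?e w" if w: "w \<in> space M" for w
    proof -
      have [measurable]: "a w \<in> space lam" "b w \<in> space lam" "m w \<in> space (prob_algebra nu)"
        using w by (auto intro: measurable_space[OF assms(1)] measurable_space[OF assms(2)] measurable_space[OF assms(3)])
      have "(\<lambda>y'. \<integral>\<^sup>+ y. ennreal (q (b w) y' (a w) y) \<partial>m w) \<in> borel_measurable nu"
        by measurable
      then show ?thesis
        by (simp add: update_altdef emeasure_density)
    qed
    ultimately show "(\<lambda>w. emeasure (update nu q mubar (a w) (b w) (m w)) B) \<in> borel_measurable M"
      by (subst measurable_cong) auto
  qed
qed

lemma filter_dist_prob:
  assumes "Q0 \<in> space (prob_algebra nu)" "\<And>k. k \<le> n \<Longrightarrow> h k \<in> space lam"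
  shows "filter_dist nu q mubar Q0 n h \<in> space (prob_algebra nu)"
  using assms(2) by (induction n) (auto simp: assms(1) intro!: update_prob)

lemma obs_kernel_altdef: "obs_kernel lam nu q x \<mu> = density lam (obs_density nu q x \<mu>)"
  by (simp add: obs_kernel_def obs_density_def[abs_def])

text \<open>
  By Tonelli, the total mass is the \<open>\<mu>\<close>-average over \<open>y\<close> of the total masses of the joint kernel at
  \<open>(x,y)\<close>, each of which is one.
\<close>

lemma obs_kernel_prob_space:
  assumes x[measurable]: "x \<in> space lam" and m[measurable]: "\<mu> \<in> space (prob_algebra nu)"
  shows "prob_space (obs_kernel lam nu q x \<mu>)"
proof (rule prob_spaceI)
  note belief_sigma_finite[OF m]
  interpret mu: prob_space \<mu> by fact
  interpret pair_sigma_finite \<mu> lam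
    by (simp add: pair_sigma_finite_def mu.sigma_finite_measure_axioms lam.sigma_finite_measure_axioms)
  have sets_mu[measurable_cong]: "sets \<mu> = sets nu" by fact
  have "emeasure (obs_kernel lam nu q x \<mu>) (space (obs_kernel lam nu q x \<mu>)) =
      (\<integral>\<^sup>+ x'. (\<integral>\<^sup>+ y. marg_density nu q x' x y \<partial>\<mu>) \<partial>lam)"
    by (auto simp: obs_kernel_altdef emeasure_density obs_density_def intro!: nn_integral_cong)
  also have "\<dots> = (\<integral>\<^sup>+ y. (\<integral>\<^sup>+ x'. marg_density nu q x' x y \<partial>lam) \<partial>\<mu>)"
    by (rule Fubini') measurable
  also have "\<dots> = (\<integral>\<^sup>+ y. 1 \<partial>\<mu>)"
  proof (rule nn_integral_cong)
    fix y assume "y \<in> space \<mu>"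
    then have y[measurable]: "y \<in> space nu"
      using sets_eq_imp_space_eq[OF sets_mu] by simp
    have [measurable]: "(\<lambda>(x', y'). ennreal (q x' y' x y)) \<in> borel_measurable (lam \<Otimes>\<^sub>M nu)"
      by measurable
    have "(\<integral>\<^sup>+ x'. marg_density nu q x' x y \<partial>lam) =
        (\<integral>\<^sup>+ z. (case z of (x', y') \<Rightarrow> ennreal (q x' y' x y)) \<partial>(lam \<Otimes>\<^sub>M nu))"
      unfolding marg_density_def by (subst nu.nn_integral_fst[symmetric]) auto
    also have "\<dots> = emeasure (joint_kernel lam nu q (x, y)) (space (lam \<Otimes>\<^sub>M nu))"
      by (auto simp: joint_kernel_def emeasure_density intro!: nn_integral_cong)
    also have "\<dots> = 1"
      using prob_space.emeasure_space_1[OF q_kernel[OF x y]] by (simp add: joint_kernel_def)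
    finally show "(\<integral>\<^sup>+ x'. marg_density nu q x' x y \<partial>lam) = 1" .
  qed
  also have "\<dots> = 1"
    by (simp add: mu.emeasure_space_1)
  finally show "emeasure (obs_kernel lam nu q x \<mu>) (space (obs_kernel lam nu q x \<mu>)) = 1" .
qed

lemma ext_integral_obs_kernel_measurable:
  assumes a[measurable]: "a \<in> M \<rightarrow>\<^sub>M lam" and m[measurable]: "m \<in> M \<rightarrow>\<^sub>M prob_algebra nu"
    and F[measurable]: "(\<lambda>(w, x'). F w x') \<in> borel_measurable (M \<Otimes>\<^sub>M lam)"
  shows "(\<lambda>w. ext_integral (obs_kernel lam nu q (a w) (m w)) (F w)) \<in> borel_measurable M"
proof -
  let ?I = "\<lambda>G w. \<integral>\<^sup>+ x'. obs_density nu q (a w) (m w) x' * G (F w x') \<partial>lam"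
  have "ext_integral (obs_kernel lam nu q (a w) (m w)) (F w) =
      enn2ereal (?I (\<lambda>v. e2ennreal (max v 0)) w) - enn2ereal (?I (\<lambda>v. e2ennreal (max (- v) 0)) w)"
    if w: "w \<in> space M" for w
  proof -
    have [measurable]: "a w \<in> space lam" "m w \<in> space (prob_algebra nu)"
      using w by (auto intro: measurable_space[OF a] measurable_space[OF m])
    have [measurable]: "F w \<in> borel_measurable lam"
      using measurable_Pair2[OF F w] by simp
    show ?thesis
      unfolding ext_integral_def obs_kernel_altdef by (subst (1 2) nn_integral_density) auto
  qed
  moreover have "(\<lambda>w. enn2ereal (?I (\<lambda>v. e2ennreal (max v 0)) w) -
      enn2ereal (?I (\<lambda>v. e2ennreal (max (- v) 0)) w)) \<in> borel_measurable M"
    by measurable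
  ultimately show ?thesis
    by (subst measurable_cong) auto
qed

text \<open>
  The recursion evaluates the previous value function at a new belief and a new accumulated reward,
  both of which depend on the integration variable. Measurability in one coordinate would therefore
  not survive the induction; joint measurability in the whole state does.
\<close>

lemma value_fun_measurable_state:
  assumes c[measurable]: "c \<in> borel_measurable lam" and g[measurable]: "g \<in> borel_measurable lam"
    and U[measurable]: "U \<in> borel_measurable borel"
  shows "(\<lambda>(x, \<mu>, s). value_fun lam nu q c g mubar n x \<mu> s U)
    \<in> borel_measurable (lam \<Otimes>\<^sub>M prob_algebra nu \<Otimes>\<^sub>M borel)"
proof (induction n)
  case 0
  show ?case by simp
next
  case (Suc n)
  let ?S = "lam \<Otimes>\<^sub>M prob_algebra nu \<Otimes>\<^sub>M (borel :: real measure)"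
  have "(\<lambda>w. (snd w, update nu q mubar (fst (fst w)) (snd w) (fst (snd (fst w))),
      snd (snd (fst w)) + c (fst (fst w)))) \<in> ?S \<Otimes>\<^sub>M lam \<rightarrow>\<^sub>M ?S"
    by measurable
  from measurable_compose[OF this Suc.IH]
  have [measurable]: "(\<lambda>(w, x'). value_fun lam nu q c g mubar n x'
      (update nu q mubar (fst w) x' (fst (snd w))) (snd (snd w) + c (fst w)) U)
      \<in> borel_measurable (?S \<Otimes>\<^sub>M lam)"
    by (simp add: case_prod_beta')
  have [measurable]: "(\<lambda>w. ext_integral (obs_kernel lam nu q (fst w) (fst (snd w))) (\<lambda>x'.
      value_fun lam nu q c g mubar n x' (update nu q mubar (fst w) x' (fst (snd w))) (snd (snd w) + c (fst w)) U))
      \<in> borel_measurable ?S"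
    by (rule ext_integral_obs_kernel_measurable) measurable
  show ?case
    unfolding value_fun.simps case_prod_beta' by measurable
qed

lemma value_fun_measurable:
  assumes c: "c \<in> borel_measurable lam" and g: "g \<in> borel_measurable lam"
    and U: "U \<in> borel_measurable borel"
    and [measurable]: "a \<in> M \<rightarrow>\<^sub>M lam" "m \<in> M \<rightarrow>\<^sub>M prob_algebra nu" "s \<in> borel_measurable M"
  shows "(\<lambda>w. value_fun lam nu q c g mubar n (a w) (m w) (s w) U) \<in> borel_measurable M"
proof -
  have "(\<lambda>w. (a w, m w, s w)) \<in> M \<rightarrow>\<^sub>M lam \<Otimes>\<^sub>M prob_algebra nu \<Otimes>\<^sub>M borel"
    by measurable
  from measurable_compose[OF this value_fun_measurable_state[OF c g U]] show ?thesis
    by simp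
qed

section \<open>Affine majorants propagate through the value iteration\<close>

text \<open>
  The continuation value inherits the bound because the same \<open>a\<close> and \<open>b\<close> serve in all states,
  and the integral preserves it; the maximum with the stopping reward then keeps it since
  \<open>v \<mapsto> a v + b\<close> is increasing.
\<close>

lemma value_fun_le_affine:
  assumes c[measurable]: "c \<in> borel_measurable lam" and g[measurable]: "g \<in> borel_measurable lam"
    and U[measurable]: "U \<in> borel_measurable borel" and W[measurable]: "W \<in> borel_measurable borel"
    and "a > 0" and le: "\<And>t. U t \<le> a * W t + b"
    and "x \<in> space lam" "\<mu> \<in> space (prob_algebra nu)"
  shows "value_fun lam nu q c g mubar n x \<mu> s U
    \<le> ereal a * value_fun lam nu q c g mubar n x \<mu> s W + ereal b"
  using assms(7-)
proof (induction n arbitrary: x \<mu> s)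
  case 0
  show ?case
    using le by simp
next
  case (Suc n)
  let ?K = "obs_kernel lam nu q x \<mu>"
  let ?V = "\<lambda>U x'. value_fun lam nu q c g mubar n x' (update nu q mubar x x' \<mu>) (s + c x) U"
  note [measurable] = Suc.prems
  have meas: "?V U \<in> borel_measurable ?K" if U: "U \<in> borel_measurable borel" for U
    unfolding obs_kernel_def measurable_density_eq1
    by (rule value_fun_measurable[OF c g U]) measurable
  have "ext_integral ?K (?V U) \<le> ereal a * ext_integral ?K (?V W) + ereal b"
    using Suc.prems
    by (intro ext_integral_affine_mono obs_kernel_prob_space meas U W \<open>a > 0\<close> Suc.IH update_prob)
       (auto simp: obs_kernel_def)
  moreover have "ereal (U (g x + s)) \<le> ereal a * ereal (W (g x + s)) + ereal b"
    using le by simp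
  moreover have "ereal a * v + ereal b \<le> ereal a * max v w + ereal b"
    "ereal a * w + ereal b \<le> ereal a * max v w + ereal b" for v w
    using \<open>a > 0\<close> by (auto intro!: add_right_mono ereal_mult_left_mono)
  ultimately show ?case
    unfolding value_fun.simps max.bounded_iff by (blast intro: order_trans)
qed

lemma value_fun_ge_stop: "ereal (U (g x + s)) \<le> value_fun lam nu q c g mubar n x \<mu> s U"
  by (cases n) auto

text \<open>
  The affine majorant is taken to touch \<open>U\<close> at the wealth \<open>g(x) + s\<close>. There the bound on the value
  for \<open>U\<close> is exactly the reward for stopping, which is always a lower bound on that value.
\<close>

lemma stop_rule_mono:
  assumes c: "c \<in> borel_measurable lam" and g: "g \<in> borel_measurable lam"
    and U: "utility U" and W: "utility W" and risk: "more_risk_averse U W"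
    and x: "x \<in> space lam" and m: "\<mu> \<in> space (prob_algebra nu)"
    and stop: "stop_rule lam nu q c g mubar n x \<mu> s W = 1"
  shows "stop_rule lam nu q c g mubar n x \<mu> s U = 1"
proof -
  obtain a b where ab: "a > 0" "\<And>t. U t \<le> a * W t + b" "U (g x + s) = a * W (g x + s) + b"
    using more_risk_averse_affine_majorant[OF U W risk] by blast
  have "value_fun lam nu q c g mubar n x \<mu> s U
      \<le> ereal a * value_fun lam nu q c g mubar n x \<mu> s W + ereal b"
    by (rule value_fun_le_affine[OF c g utility_borel_measurable[OF U] utility_borel_measurable[OF W]
          ab(1,2) x m])
  also have "\<dots> = ereal (U (g x + s))"
    using stop ab(3) by (simp add: stop_rule_def split: if_splits)
  finally show ?thesis
    using value_fun_ge_stop[of U g x s c n \<mu>] by (simp add: stop_rule_def)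
qed

end

lemma measure_on_borel_space_space:
  assumes "measure_on_borel_space E M"
  shows "space M = E"
  using assms sets_eq_imp_space_eq[of M "restrict_space borel E"]
  by (simp add: measure_on_borel_space_def space_restrict_space)

theorem theorem3p4:
  fixes E\<^sub>X :: "'x::polish_space set" and E\<^sub>Y :: "'y::polish_space set"
    and lam :: "'x measure" and nu :: "'y measure"
    and q :: "'x \<Rightarrow> 'y \<Rightarrow> 'x \<Rightarrow> 'y \<Rightarrow> real"
    and c g :: "'x \<Rightarrow> real"
    and Q0 mubar :: "'y measure"
    and U W :: "real \<Rightarrow> real"
    and N :: nat
  assumes spaceX: "measure_on_borel_space E\<^sub>X lam" "sigma_finite_measure lam"
    and spaceY: "measure_on_borel_space E\<^sub>Y nu" "sigma_finite_measure nu"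
    and q_measurable:
      "(\<lambda>((x', y'), (x, y)). q x' y' x y)
         \<in> borel_measurable ((lam \<Otimes>\<^sub>M nu) \<Otimes>\<^sub>M (lam \<Otimes>\<^sub>M nu))"
    and q_nonneg: "\<forall>x'\<in>E\<^sub>X. \<forall>y'\<in>E\<^sub>Y. \<forall>x\<in>E\<^sub>X. \<forall>y\<in>E\<^sub>Y. 0 \<le> q x' y' x y"
    and q_kernel: "\<forall>x\<in>E\<^sub>X. \<forall>y\<in>E\<^sub>Y. prob_space (joint_kernel lam nu q (x, y))"
    and c: "c \<in> borel_measurable lam" and g: "g \<in> borel_measurable lam"
    and Q0: "Q0 \<in> space (prob_algebra nu)"
    and mubar: "mubar \<in> space (prob_algebra nu)"
    and integrability:
      "\<forall>x\<in>E\<^sub>X. (SUP \<tau>\<in>stopping_times_upto lam nu N.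
                 SUP y\<in>E\<^sub>Y. exp_pos_reward lam nu q c g \<tau> x y) < \<infinity>"
    and U: "utility U" and W: "utility W"
    and risk: "more_risk_averse U W"
  shows "(\<forall>n<N. \<forall>h. (\<forall>k\<le>n. h k \<in> E\<^sub>X) \<longrightarrow>
            hist_rule lam nu q c g mubar Q0 N n h W = 1 \<longrightarrow>
            hist_rule lam nu q c g mubar Q0 N n h U = 1)
       \<and> (\<forall>h. (\<forall>k<N. h k \<in> E\<^sub>X) \<longrightarrow>
            opt_stop lam nu q c g mubar Q0 N h U \<le> opt_stop lam nu q c g mubar Q0 N h W)"
proof -
  have space: "space lam = E\<^sub>X" "space nu = E\<^sub>Y"
    using spaceX(1) spaceY(1) by (auto dest: measure_on_borel_space_space)
  interpret density_model lam nu q mubar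
    using spaceX spaceY q_measurable q_kernel mubar space
    by (auto simp: density_model_def density_model_axioms_def)
  have rule: "hist_rule lam nu q c g mubar Q0 N n h U = 1"
    if "\<forall>k\<le>n. h k \<in> E\<^sub>X" "hist_rule lam nu q c g mubar Q0 N n h W = 1" for n h
    using that unfolding hist_rule_def
    by (intro stop_rule_mono[OF c g U W risk] filter_dist_prob[OF Q0]) (auto simp: space)
  have "opt_stop lam nu q c g mubar Q0 N h U \<le> opt_stop lam nu q c g mubar Q0 N h W"
    if h: "\<forall>k<N. h k \<in> E\<^sub>X" for h
  proof -
    let ?P = "\<lambda>U n. n = N \<or> (n < N \<and> hist_rule lam nu q c g mubar Q0 N n h U = 1)"
    have "?P W (LEAST n. ?P W n)"
      by (rule LeastI[of _ N]) simp
    \<comment> \<open>Either the time is \<open>N\<close>, or the history up to it lies in the state space and \<open>rule\<close> applies.\<close>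
    then have "?P U (LEAST n. ?P W n)"
      using h rule by auto
    then show ?thesis
      unfolding opt_stop_def by (rule Least_le)
  qed
  with rule show ?thesis
    by blast
qed

end
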